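(* Let $A,B$ be positive definite matrices. Then \[ A\,\widehat{sp}_{-1}\,B\prec_{\log}AB^{-1}A. \]
   Context: For positive definite matrices $A,B$ and $t\in\mathbb{R}$: $A\sharp B:=A^{1/2}(A^{-1/2}BA^{-1/2})^{1/2}A^{1/2}$ and $A\,\widehat{sp}_t\,B:=(A^{-1}\sharp B)^tA(A^{-1}\sharp B)^t$; so $A\,\widehat{sp}_{-1}\,B=(A^{-1}\sharp B)^{-1}A(A^{-1}\sharp B)^{-1}$. For $n\times n$ positive semidefinite matrices $X,Y$ with eigenvalues $\lambda_1(\cdot)\ge\dots\ge\lambda_n(\cdot)$, $X\prec_{\log}Y$ means $\prod_{j=1}^k\lambda_j(X)\le\prod_{j=1}^k\lambda_j(Y)$ for $k=1,\dots,n-1$ and $\det X=\det Y$. *)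

theory Defs
  imports "Jordan_Normal_Form.Schur_Decomposition"
begin

definition hermitian_mat :: "complex mat \<Rightarrow> bool" where
  "hermitian_mat A \<longleftrightarrow> A \<in> carrier_mat (dim_row A) (dim_row A) \<and> mat_adjoint A = A"

definition pos_def_mat :: "complex mat \<Rightarrow> bool" where
  "pos_def_mat A \<longleftrightarrow> hermitian_mat A \<and>
     (\<forall>v \<in> carrier_vec (dim_row A). v \<noteq> 0\<^sub>v (dim_row A) \<longrightarrow>
        Re (conjugate v \<bullet> (A *\<^sub>v v)) > 0)"

definition pos_semidef_mat :: "complex mat \<Rightarrow> bool" where
  "pos_semidef_mat A \<longleftrightarrow> hermitian_mat A \<and>
     (\<forall>v \<in> carrier_vec (dim_row A). Re (conjugate v \<bullet> (A *\<^sub>v v)) \<ge> 0)"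

definition minv :: "complex mat \<Rightarrow> complex mat" where
  "minv A = (THE B. B \<in> carrier_mat (dim_row A) (dim_row A) \<and>
                    A * B = 1\<^sub>m (dim_row A) \<and> B * A = 1\<^sub>m (dim_row A))"

definition msqrt :: "complex mat \<Rightarrow> complex mat" where
  "msqrt A = (THE S. S \<in> carrier_mat (dim_row A) (dim_row A) \<and> pos_semidef_mat S \<and> S * S = A)"

definition geo_mean :: "complex mat \<Rightarrow> complex mat \<Rightarrow> complex mat" where
  "geo_mean A B = msqrt A * msqrt (minv (msqrt A) * B * minv (msqrt A)) * msqrt A"

definition sp_hat_m1 :: "complex mat \<Rightarrow> complex mat \<Rightarrow> complex mat" where
  "sp_hat_m1 A B = minv (geo_mean (minv A) B) * A * minv (geo_mean (minv A) B)"

definition eigs_desc :: "complex mat \<Rightarrow> real list" where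
  "eigs_desc X = (THE ls. length ls = dim_row X \<and> sorted_wrt (\<ge>) ls \<and>
       char_poly X = (\<Prod>l\<leftarrow>ls. [:- complex_of_real l, 1:]))"

definition log_majorized :: "complex mat \<Rightarrow> complex mat \<Rightarrow> bool" where
  "log_majorized X Y \<longleftrightarrow>
     (\<forall>k\<in>{1..<dim_row X}. (\<Prod>j<k. eigs_desc X ! j) \<le> (\<Prod>j<k. eigs_desc Y ! j))
     \<and> det X = det Y"

end

theory Submission
  imports Defs
begin

text \<open>
  The geometric mean \<open>G = A\<^sup>-\<^sup>1 \<sharp> B\<close> satisfies \<open>G A G = B\<close>. With \<open>H = G\<^sup>-\<^sup>1\<close> and \<open>C = A\<^sup>1\<^sup>/\<^sup>2\<close> the
  claim compares \<open>H A H\<close>, whose eigenvalues are those of \<open>(C H) (C H)\<^sup>*\<close>, with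
  \<open>A B\<^sup>-\<^sup>1 A = M\<^sup>* M\<close>, where \<open>M = C\<^sup>-\<^sup>1 H A\<close>. The key is the factorization \<open>H C \<cdot> M = H\<^sup>2 A\<close>: the
  left side is bounded by singular values, while the right side is similar to \<open>H A H\<close>.
  If \<open>p\<close> and \<open>q\<close> are the products of the \<open>k\<close> largest eigenvalues of \<open>H A H\<close> and \<open>A B\<^sup>-\<^sup>1 A\<close>, and the
  columns of \<open>V\<close> are the corresponding eigenvectors of \<open>H\<^sup>2 A\<close>, then comparing Gram determinants of
  \<open>H\<^sup>2 A V\<close> and \<open>V\<close> gives \<open>p\<^sup>2 \<le> p q\<close>.
\<close>

section \<open>Adjoints and positive semidefinite matrices\<close>

lemma mat_adjoint_dim [simp]:
  "dim_row (mat_adjoint A) = dim_col A" "dim_col (mat_adjoint A) = dim_row A"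
  by (auto simp: mat_adjoint_def)

lemma mat_adjoint_carrier [simp]:
  "A \<in> carrier_mat n m \<Longrightarrow> mat_adjoint A \<in> carrier_mat m n"
  by (auto intro!: carrier_matI)

lemma mat_adjoint_index [simp]:
  "i < dim_col A \<Longrightarrow> j < dim_row A \<Longrightarrow> mat_adjoint A $$ (i, j) = conjugate (A $$ (j, i))"
  by (auto simp: mat_adjoint_def mat_of_rows_index)

lemma mat_adjoint_adjoint [simp]: "mat_adjoint (mat_adjoint A) = A"
  by (rule eq_matI) auto

lemma mat_adjoint_mult:
  fixes A B :: "complex mat"
  assumes "A \<in> carrier_mat n m" "B \<in> carrier_mat m l"
  shows "mat_adjoint (A * B) = mat_adjoint B * mat_adjoint A"
  using assms by (intro eq_matI) (auto simp: scalar_prod_def mult.commute)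

lemma mat_adjoint_one [simp]: "mat_adjoint (1\<^sub>m n :: complex mat) = 1\<^sub>m n"
  by (rule eq_matI) auto

lemma mat_adjoint_diag_of_real:
  "mat_adjoint (mat_diag n (\<lambda>i. complex_of_real (d i))) = mat_diag n (\<lambda>i. complex_of_real (d i))"
  by (rule eq_matI) (auto simp: mat_diag_def)

lemma conjugate_scalar_prod_mult_mat_vec:
  fixes A :: "complex mat"
  assumes "A \<in> carrier_mat n m" "v \<in> carrier_vec n" "w \<in> carrier_vec m"
  shows "conjugate v \<bullet> (A *\<^sub>v w) = conjugate (mat_adjoint A *\<^sub>v v) \<bullet> w"
proof -
  have "conjugate v \<bullet> (A *\<^sub>v w) = (\<Sum>i<n. \<Sum>j<m. cnj (v $ i) * (A $$ (i,j) * w $ j))"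
    using assms by (simp add: scalar_prod_def sum_distrib_left atLeast0LessThan)
  also have "\<dots> = (\<Sum>j<m. \<Sum>i<n. cnj (v $ i) * (A $$ (i,j) * w $ j))"
    by (rule sum.swap)
  also have "\<dots> = conjugate (mat_adjoint A *\<^sub>v v) \<bullet> w"
    using assms by (simp add: scalar_prod_def sum_distrib_left atLeast0LessThan mult_ac)
  finally show ?thesis .
qed

text \<open>When the columns of \<open>W\<close> are eigenvectors that diagonalize \<open>P\<close>,
  this exhibits the eigenvalues as values of the quadratic form, which makes their signs
  accessible.\<close>

lemma adjoint_congruence_diagonal:
  fixes P :: "complex mat"
  assumes "P \<in> carrier_mat n n" "W \<in> carrier_mat n k" "i < k"
  shows "(mat_adjoint W * P * W) $$ (i, i) = conjugate (col W i) \<bullet> (P *\<^sub>v col W i)"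
proof -
  have r: "row (mat_adjoint W) i = conjugate (col W i)"
    using assms by (intro eq_vecI) auto
  have "mat_adjoint W * P * W = mat_adjoint W * (P * W)"
    using assms by (intro assoc_mult_mat) auto
  moreover have "col (P * W) i = P *\<^sub>v col W i"
    using assms by (intro eq_vecI) auto
  ultimately show ?thesis using assms r by (metis carrier_matD index_mult_mat mat_adjoint_dim(1))
qed

text \<open>Moving \<open>Z\<close> across the inner product turns the quadratic form at
  \<open>v\<close> into that of \<open>P\<close> at \<open>Z *\<^sub>v v\<close>.\<close>

lemma pos_semidef_congruence:
  assumes P: "P \<in> carrier_mat n n" "pos_semidef_mat P" and Z: "Z \<in> carrier_mat n n"
  shows "pos_semidef_mat (mat_adjoint Z * P * Z)"
proof -
  have h: "mat_adjoint P = P" using P by (auto simp: pos_semidef_mat_def hermitian_mat_def)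
  have c: "mat_adjoint Z * P * Z \<in> carrier_mat n n" using P Z by auto
  have "mat_adjoint (mat_adjoint Z * P * Z) = mat_adjoint Z * P * Z"
    using P Z h by (simp add: mat_adjoint_mult[of _ n n _ n] assoc_mult_mat[of _ n n _ n _ n])
  moreover have "Re (conjugate v \<bullet> (mat_adjoint Z * P * Z *\<^sub>v v)) \<ge> 0" if v: "v \<in> carrier_vec n" for v
  proof -
    have "conjugate v \<bullet> (mat_adjoint Z * P * Z *\<^sub>v v) = conjugate v \<bullet> (mat_adjoint Z *\<^sub>v (P *\<^sub>v (Z *\<^sub>v v)))"
      using P Z v by (simp add: assoc_mult_mat_vec[of _ n n _ n] mult_carrier_mat[of _ n n _ n])
    also have "\<dots> = conjugate (Z *\<^sub>v v) \<bullet> (P *\<^sub>v (Z *\<^sub>v v))"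
      using P Z v by (subst conjugate_scalar_prod_mult_mat_vec[of _ n n]) auto
    finally show ?thesis using P Z v by (auto simp: pos_semidef_mat_def)
  qed
  ultimately show ?thesis using c by (auto simp: pos_semidef_mat_def hermitian_mat_def)
qed

lemma pos_semidef_one: "pos_semidef_mat (1\<^sub>m n)"
proof -
  have "Re (conjugate v \<bullet> (v :: complex vec)) \<ge> 0" if "v \<in> carrier_vec n" for v
    using that by (auto simp: scalar_prod_def intro!: add_nonneg_nonneg sum_nonneg)
  then show ?thesis by (auto simp: pos_semidef_mat_def hermitian_mat_def)
qed

lemma pos_semidef_gram:
  assumes "Z \<in> carrier_mat n n"
  shows "pos_semidef_mat (mat_adjoint Z * Z)"
  using pos_semidef_congruence[OF one_carrier_mat pos_semidef_one assms] assms by simp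

lemma pos_def_imp_pos_semidef:
  assumes "pos_def_mat A"
  shows "pos_semidef_mat A"
proof -
  have "Re (conjugate v \<bullet> (A *\<^sub>v v)) \<ge> 0" if v: "v \<in> carrier_vec (dim_row A)" for v
  proof (cases "v = 0\<^sub>v (dim_row A)")
    case True
    then have "conjugate v = 0\<^sub>v (dim_row A)" by (intro eq_vecI) auto
    moreover have "A *\<^sub>v v \<in> carrier_vec (dim_row A)" by (simp add: carrier_vecI)
    ultimately show ?thesis by simp
  next
    case False
    then show ?thesis using assms v by (auto simp: pos_def_mat_def less_imp_le)
  qed
  then show ?thesis using assms by (simp add: pos_def_mat_def pos_semidef_mat_def)
qed

lemma pos_def_det_nonzero:
  assumes A: "A \<in> carrier_mat n n" and pd: "pos_def_mat A"
  shows "det A \<noteq> 0"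
proof
  assume "det A = 0"
  then obtain v where v: "v \<in> carrier_vec n" "v \<noteq> 0\<^sub>v n" "A *\<^sub>v v = 0\<^sub>v n"
    using det_0_iff_vec_prod_zero[OF A] by blast
  then have "Re (conjugate v \<bullet> 0\<^sub>v n) > 0"
    using A pd unfolding pos_def_mat_def by (metis carrier_matD(1))
  then show False using v(1) by simp
qed

section \<open>Inverses\<close>

text \<open>For square matrices over a field a right inverse is also a left inverse. This gives both
  the existence and the uniqueness that the definite description in \<open>minv\<close>
  requires.\<close>

lemma minv_eqI:
  assumes A: "A \<in> carrier_mat n n" and B: "B \<in> carrier_mat n n" and AB: "A * B = 1\<^sub>m n"
  shows "minv A = B"
proof -
  have BA: "B * A = 1\<^sub>m n" using mat_mult_left_right_inverse[OF A B AB] .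
  have "D = B" if D: "D \<in> carrier_mat n n" "A * D = 1\<^sub>m n" for D
  proof -
    have "D = (B * A) * D" using D BA by simp
    also have "\<dots> = B * (A * D)" using A B D by (intro assoc_mult_mat) auto
    finally show ?thesis using B D by simp
  qed
  then have u: "\<And>D. D \<in> carrier_mat n n \<and> A * D = 1\<^sub>m n \<and> D * A = 1\<^sub>m n \<Longrightarrow> D = B" by blast
  have "dim_row A = n" using A by simp
  then show ?thesis unfolding minv_def using B AB BA by (simp only:) (rule the_equality, blast, rule u)
qed

lemma minv_inverse:
  assumes A: "A \<in> carrier_mat n n" and "det A \<noteq> 0"
  shows "minv A \<in> carrier_mat n n" "A * minv A = 1\<^sub>m n" "minv A * A = 1\<^sub>m n"
proof -
  obtain B where B: "B \<in> carrier_mat n n" "A * B = 1\<^sub>m n"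
    using det_non_zero_imp_unit[OF assms] unfolding Units_def ring_mat_def by auto
  have "minv A = B" using minv_eqI[OF A B] .
  then show "minv A \<in> carrier_mat n n" "A * minv A = 1\<^sub>m n" "minv A * A = 1\<^sub>m n"
    using B mat_mult_left_right_inverse[OF A B] by auto
qed

lemma minv_adjoint:
  assumes A: "A \<in> carrier_mat n n" and d: "det A \<noteq> 0" and h: "mat_adjoint A = A"
  shows "mat_adjoint (minv A) = minv A"
proof -
  note i = minv_inverse[OF A d]
  have "A * mat_adjoint (minv A) = mat_adjoint (minv A * A)"
    using A i(1) h by (subst mat_adjoint_mult[of _ n n _ n]) auto
  then show ?thesis using minv_eqI[OF A _, of "mat_adjoint (minv A)"] i by simp
qed

section \<open>Gram determinants with diagonal weights\<close>

text \<open>A symmetrized Cauchy-Binet formula: summing over all maps \<open>f\<close> instead of all \<open>k\<close>-subsets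
  counts every minor \<open>k!\<close> times.\<close>

lemma det_gram_diag:
  fixes W :: "complex mat" and d :: "nat \<Rightarrow> real"
  assumes W: "W \<in> carrier_mat n k"
  shows "fact k * det (mat_adjoint W * mat_diag n (\<lambda>i. of_real (d i)) * W) =
    of_real (\<Sum>f\<in>{0..<k} \<rightarrow>\<^sub>E {0..<n}. (\<Prod>i<k. d (f i)) *
      (cmod (det (mat k k (\<lambda>(i, j). W $$ (f i, j)))))\<^sup>2)"
proof -
  define F where "F = {0..<k} \<rightarrow>\<^sub>E {0..<n}"
  define S where "S f = mat k k (\<lambda>(i, j). W $$ (f i, j))" for f :: "nat \<Rightarrow> nat"
  define D where "D f = (\<Prod>i<k. d (f i))" for f :: "nat \<Rightarrow> nat"
  \<comment> \<open>\<open>g f\<close> is the contribution of the map \<open>f\<close> to the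
    Leibniz expansion of the determinant, after the sum over permutations has been collected into
    \<open>det (S f)\<close>.\<close>
  define g where "g f = (\<Prod>i<k. cnj (W $$ (f i, i))) * of_real (D f) * det (S f)" for f
  define Sn where "Sn = {p. p permutes {0..<k}}"
  let ?G = "mat_adjoint W * mat_diag n (\<lambda>i. of_real (d i)) * W"
  have S [simp]: "S f \<in> carrier_mat k k" for f by (simp add: S_def)
  have G: "?G \<in> carrier_mat k k" using W by auto
  have entry: "?G $$ (i, j) = (\<Sum>l\<in>{0..<n}. cnj (W $$ (l, i)) * of_real (d l) * W $$ (l, j))"
    if "i < k" "j < k" for i j
    using that W by (subst mat_diag_mult_right[of _ k n]) (auto simp: scalar_prod_def)
  have "det ?G = (\<Sum>p\<in>Sn. signof p * (\<Prod>i=0..<k. \<Sum>l\<in>{0..<n}. cnj (W $$ (l, i)) * of_real (d l) * W $$ (l, p i)))"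
    unfolding det_def'[OF G] Sn_def
    by (intro sum.cong prod.cong refl arg_cong2[of _ _ _ _ "(*)"] entry) (auto simp: permutes_in_image)
  \<comment> \<open>Expanding the product of sums chooses one index \<open>l\<close> for every
    \<open>i\<close>, which is a map in \<open>F\<close>.\<close>
  also have "\<dots> = (\<Sum>p\<in>Sn. signof p * (\<Sum>f\<in>F. \<Prod>i=0..<k. cnj (W $$ (f i, i)) * of_real (d (f i)) * W $$ (f i, p i)))"
    by (simp add: prod_sum_PiE F_def)
  also have "\<dots> = (\<Sum>p\<in>Sn. \<Sum>f\<in>F. (\<Prod>i<k. cnj (W $$ (f i, i))) * of_real (D f) * (signof p * (\<Prod>i=0..<k. W $$ (f i, p i))))"
    by (simp add: sum_distrib_left prod.distrib D_def mult_ac atLeast0LessThan)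
  also have "\<dots> = (\<Sum>f\<in>F. \<Sum>p\<in>Sn. (\<Prod>i<k. cnj (W $$ (f i, i))) * of_real (D f) * (signof p * (\<Prod>i=0..<k. W $$ (f i, p i))))"
    by (rule sum.swap)
  also have "\<dots> = (\<Sum>f\<in>F. g f)"
    unfolding g_def det_def'[OF S] sum_distrib_left
    by (intro sum.cong prod.cong refl arg_cong2[of _ _ _ _ "(*)"])
       (auto simp: Sn_def S_def permutes_in_image)
  finally have 1: "det ?G = (\<Sum>f\<in>F. g f)" .
  \<comment> \<open>Precomposition with a permutation is a bijection of \<open>F\<close>. The total
    is therefore unchanged when \<open>g\<close> is evaluated at \<open>f \<circ> p\<close>, and
    averaging over \<open>p\<close> will symmetrize it.\<close>
  have 2: "(\<Sum>f\<in>F. g f) = (\<Sum>f\<in>F. g (f \<circ> p))" if p: "p \<in> Sn" for p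
  proof (rule sum.reindex_bij_witness[of _ "\<lambda>f. f \<circ> p" "\<lambda>f. f \<circ> Hilbert_Choice.inv p"])
    from p have pp: "p permutes {0..<k}" and ip: "Hilbert_Choice.inv p permutes {0..<k}"
      by (auto simp: Sn_def permutes_inv)
    have *: "f \<circ> q \<in> F" if "f \<in> F" "q permutes {0..<k}" for f q
      unfolding F_def
    proof (rule PiE_I)
      fix x assume "x \<in> {0..<k}"
      then have "q x \<in> {0..<k}" using permutes_in_image[OF that(2)] by blast
      then show "(f \<circ> q) x \<in> {0..<n}" using that(1) by (auto simp: F_def)
    next
      \<comment> \<open>Maps in \<open>F\<close> take the default value \<open>undefined\<close>
        outside \<open>{0..<k}\<close>; the permutation fixes these points, so the default survives
        composition.\<close>
      fix x assume x: "x \<notin> {0..<k}"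
      then have "q x = x" using that(2) by (auto simp: permutes_def)
      then show "(f \<circ> q) x = undefined" using PiE_arb[OF that(1)[unfolded F_def] x] by simp
    qed
    show "f \<circ> Hilbert_Choice.inv p \<in> F" "f \<circ> p \<in> F" if "f \<in> F" for f using *[OF that] pp ip by auto
    show "(f \<circ> Hilbert_Choice.inv p) \<circ> p = f" "(f \<circ> p) \<circ> Hilbert_Choice.inv p = f" for f :: "nat \<Rightarrow> nat"
      using pp by (auto simp: comp_assoc permutes_inv_o)
    then show "g (f \<circ> Hilbert_Choice.inv p \<circ> p) = g f" for f by simp
  qed
  \<comment> \<open>Precomposition permutes the rows of \<open>S f\<close>, which contributes the
    sign, and only reorders the factors of \<open>D f\<close>.\<close>
  have 3: "g (f \<circ> p) = of_real (D f) * det (S f) * (signof p * (\<Prod>i<k. cnj (W $$ (f (p i), i))))"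
    if p: "p \<in> Sn" for f p
  proof -
    from p have pp: "p permutes {0..<k}" by (simp add: Sn_def)
    have "D (f \<circ> p) = D f"
      using prod.permute[OF pp, of "\<lambda>i. d (f i)"] by (simp add: D_def o_def atLeast0LessThan)
    moreover have "det (S (f \<circ> p)) = signof p * det (S f)"
    proof -
      have "S (f \<circ> p) = mat k k (\<lambda>(i, j). S f $$ (p i, j))"
        using permutes_in_image[OF pp] by (intro eq_matI) (auto simp: S_def)
      then show ?thesis using det_permute_rows[OF S pp] by simp
    qed
    ultimately show ?thesis by (simp add: g_def)
  qed
  have card: "card Sn = fact k" by (simp add: Sn_def card_permutations)
  \<comment> \<open>Summed over \<open>p\<close>, the remaining factors form the Leibniz expansion
    of the conjugate minor. Together with \<open>det (S f)\<close> it produces the squared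
    modulus.\<close>
  have 4: "(\<Sum>p\<in>Sn. signof p * (\<Prod>i<k. cnj (W $$ (f (p i), i)))) = cnj (det (S f))" for f
  proof -
    have "cnj (signof p) = (signof p :: complex)" for p :: "nat \<Rightarrow> nat"
      by (simp add: sign_def)
    moreover have "(\<Prod>i<k. cnj (W $$ (f (p i), i))) = (\<Prod>i<k. cnj (S f $$ (p i, i)))" if "p \<in> Sn" for p
    proof (rule prod.cong)
      fix i assume "i \<in> {..<k}"
      then have "p i < k" using that permutes_in_image[of p "{0..<k}" i] by (auto simp: Sn_def)
      then show "cnj (W $$ (f (p i), i)) = cnj (S f $$ (p i, i))" using \<open>i \<in> _\<close> by (simp add: S_def)
    qed simp
    ultimately show ?thesis by (simp add: det_col[OF S] Sn_def)
  qed
  have "fact k * det ?G = (\<Sum>p\<in>Sn. \<Sum>f\<in>F. g f)" by (simp add: 1 card)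
  also have "\<dots> = (\<Sum>p\<in>Sn. \<Sum>f\<in>F. of_real (D f) * det (S f) * (signof p * (\<Prod>i<k. cnj (W $$ (f (p i), i)))))"
    by (rule sum.cong[OF refl]) (simp add: 2 3)
  also have "\<dots> = (\<Sum>f\<in>F. of_real (D f) * det (S f) * cnj (det (S f)))"
    by (subst sum.swap) (simp add: sum_distrib_left[symmetric] 4)
  also have "\<dots> = of_real (\<Sum>f\<in>F. D f * (cmod (det (S f)))\<^sup>2)"
    by (simp add: complex_norm_square mult.assoc del: of_real_power)
  finally show ?thesis by (simp add: F_def D_def S_def)
qed

section \<open>Unitary diagonalization of hermitian matrices\<close>

text \<open>Gram-Schmidt is applied to a basis that starts with \<open>v\<close>, and the resulting
  vectors are normalized. This supplies the basis change that splits off one eigenvector.\<close>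

lemma unitary_with_first_column:
  fixes v :: "complex vec"
  assumes v: "v \<in> carrier_vec n" and v0: "v \<noteq> 0\<^sub>v n"
  shows "\<exists>W c. W \<in> carrier_mat n n \<and> mat_adjoint W * W = 1\<^sub>m n \<and> col W 0 = c \<cdot>\<^sub>v v"
proof -
  interpret cof_vec_space n "TYPE(complex)" .
  define ws where "ws = gram_schmidt n (basis_completion v)"
  note b = basis_completion[OF v v0]
  note gs = gram_schmidt_result[OF b(2,4,5) refl, folded ws_def]
  have orth: "corthogonal ws" and len: "length ws = n" using gs b(6) by auto
  have wc: "ws ! j \<in> carrier_vec n" if "j < n" for j using gs(3) len that by auto
  have n: "n > 0" using v v0 by (cases n) auto
  then obtain vs where "basis_completion v = v # vs"
    using b(6,7) by (cases "basis_completion v") auto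
  \<comment> \<open>Orthogonalization leaves the first vector of the list unchanged.\<close>
  then have "hd ws = v" using gram_schmidt_hd[OF v, of vs] by (simp add: ws_def)
  then have ws0: "ws ! 0 = v" using len n by (cases ws) auto
  \<comment> \<open>The list \<open>ws\<close> is only orthogonal, so the squared norms
    \<open>r j\<close> are needed for the normalization.\<close>
  define r where "r j = (\<Sum>l<n. (cmod (ws ! j $ l))\<^sup>2)" for j
  have wr: "ws ! j \<bullet>c ws ! j = of_real (r j)" if "j < n" for j
    using wc[OF that]
    by (simp add: scalar_prod_def r_def complex_norm_square atLeast0LessThan del: of_real_power)
  have r: "r j > 0" if "j < n" for j
  proof -
    have "r j \<noteq> 0" using corthogonalD[OF orth, of j j] wr[OF that] that len by auto
    moreover have "r j \<ge> 0" by (auto simp: r_def intro!: sum_nonneg)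
    ultimately show ?thesis by simp
  qed
  define W where "W = mat n n (\<lambda>(i, j). ws ! j $ i / of_real (sqrt (r j)))"
  have W: "W \<in> carrier_mat n n" by (simp add: W_def)
  have "mat_adjoint W * W = 1\<^sub>m n"
  proof (rule eq_matI)
    fix i j assume "i < dim_row (1\<^sub>m n :: complex mat)" "j < dim_col (1\<^sub>m n :: complex mat)"
    then have ij: "i < n" "j < n" by auto
    have "(mat_adjoint W * W) $$ (i, j) = (\<Sum>l=0..<n. ws ! j $ l * cnj (ws ! i $ l) / of_real (sqrt (r i) * sqrt (r j)))"
      using ij by (simp add: W_def scalar_prod_def mult_ac)
    also have "\<dots> = (ws ! j \<bullet>c ws ! i) / of_real (sqrt (r i) * sqrt (r j))"
      using wc[OF ij(1)] wc[OF ij(2)] by (simp add: scalar_prod_def sum_divide_distrib)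
    also have "\<dots> = 1\<^sub>m n $$ (i, j)"
    proof (cases "i = j")
      case True
      then show ?thesis using ij r[OF ij(1)] wr[OF ij(1)] by simp
    next
      case False
      then show ?thesis using ij corthogonalD[OF orth, of j i] len by simp
    qed
    finally show "(mat_adjoint W * W) $$ (i, j) = 1\<^sub>m n $$ (i, j)" .
  qed (auto simp: W_def)
  moreover have "col W 0 = (1 / of_real (sqrt (r 0))) \<cdot>\<^sub>v v"
    using n v ws0 by (intro eq_vecI) (auto simp: W_def)
  ultimately show ?thesis using W by blast
qed

text \<open>Induction on the list of roots: each step splits off an eigenvector for the head of the
  list. The list is prescribed by the caller, so the diagonal can be obtained in any desired order,
  in particular a decreasing one.\<close>

lemma hermitian_diagonalization:
  fixes A :: "complex mat"
  assumes "A \<in> carrier_mat n n" "mat_adjoint A = A" "char_poly A = (\<Prod>e\<leftarrow>es. [:- e, 1:])"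
  shows "\<exists>U. U \<in> carrier_mat n n \<and> mat_adjoint U * U = 1\<^sub>m n \<and>
    mat_adjoint U * A * U = mat_diag n (\<lambda>i. es ! i)"
  using assms
proof (induction es arbitrary: n A)
  case Nil
  then have "n = 0" using degree_monic_char_poly[of A n] by auto
  then show ?case by (intro exI[of _ "1\<^sub>m n"]) (auto intro!: eq_matI simp: mat_diag_def)
next
  case (Cons e es)
  note A = Cons.prems(1) and h = Cons.prems(2)
  have "eigenvalue A e" using Cons.prems(3) by (simp add: eigenvalue_root_char_poly[OF A])
  then obtain v where v: "v \<in> carrier_vec n" "v \<noteq> 0\<^sub>v n" "A *\<^sub>v v = e \<cdot>\<^sub>v v"
    using A by (auto simp: eigenvalue_def eigenvector_def)
  obtain m where n: "n = Suc m" using v by (cases n) auto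
  obtain W c where W: "W \<in> carrier_mat n n" "mat_adjoint W * W = 1\<^sub>m n" "col W 0 = c \<cdot>\<^sub>v v"
    using unitary_with_first_column[OF v(1,2)] by blast
  have aW: "mat_adjoint W \<in> carrier_mat n n" using W by simp
  define A' where "A' = mat_adjoint W * A * W"
  have A': "A' \<in> carrier_mat n n" using W A by (auto simp: A'_def)
  have h': "mat_adjoint A' = A'"
    using W A h by (simp add: A'_def mat_adjoint_mult[of _ n n _ n] assoc_mult_mat[of _ n n _ n _ n]
        mult_carrier_mat[of _ n n _ n])
  \<comment> \<open>The first column of \<open>W\<close> is an eigenvector of \<open>A\<close>, so
    in the new basis the first column becomes \<open>e\<close> times the first unit vector.\<close>
  have "col A' 0 = mat_adjoint W *\<^sub>v (A *\<^sub>v col W 0)"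
  proof -
    have "A' = mat_adjoint W * (A * W)" unfolding A'_def using assoc_mult_mat[OF aW A W(1)] .
    moreover have "col (mat_adjoint W * (A * W)) 0 = mat_adjoint W *\<^sub>v col (A * W) 0"
      using A W n by (intro eq_vecI) auto
    moreover have "col (A * W) 0 = A *\<^sub>v col W 0" using A W n by (intro eq_vecI) auto
    ultimately show ?thesis by simp
  qed
  also have "A *\<^sub>v col W 0 = e \<cdot>\<^sub>v col W 0"
    using A v W by (simp add: mult_mat_vec[of A n n] smult_smult_assoc mult.commute)
  also have "mat_adjoint W *\<^sub>v (e \<cdot>\<^sub>v col W 0) = e \<cdot>\<^sub>v (mat_adjoint W *\<^sub>v col W 0)"
    using aW W v n by (intro mult_mat_vec[of _ n n]) auto
  also have "mat_adjoint W *\<^sub>v col W 0 = col (1\<^sub>m n) 0"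
    unfolding W(2)[symmetric] using W(1) n by (intro eq_vecI) auto
  finally have col0: "col A' 0 = e \<cdot>\<^sub>v col (1\<^sub>m n) 0" .
  have A'0: "A' $$ (i, 0) = (if i = 0 then e else 0)" if "i < n" for i
    using arg_cong[OF col0, of "\<lambda>w. w $ i"] A' n that by (auto simp: one_mat_def split: if_splits)
  \<comment> \<open>Hermitian symmetry carries the zeros of the first column over to the first
    row.\<close>
  have A'0r: "A' $$ (0, i) = 0" if "i < n" "i \<noteq> 0" for i
    using that n A' A'0[of i] arg_cong[OF h', of "\<lambda>M. M $$ (0, i)"] by simp
  define A3 where "A3 = mat m m (\<lambda>(i, j). A' $$ (Suc i, Suc j))"
  have A3: "A3 \<in> carrier_mat m m" by (simp add: A3_def)
  define E where "E = mat 1 1 (\<lambda>_. e)"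
  have E: "E \<in> carrier_mat 1 1" by (simp add: E_def)
  have block: "A' = four_block_mat E (0\<^sub>m 1 m) (0\<^sub>m m 1) A3"
  proof (rule eq_matI)
    fix i j assume "i < dim_row (four_block_mat E (0\<^sub>m 1 m) (0\<^sub>m m 1) A3)"
      "j < dim_col (four_block_mat E (0\<^sub>m 1 m) (0\<^sub>m m 1) A3)"
    then have "i < n" "j < n" using n E A3 by auto
    then show "A' $$ (i, j) = four_block_mat E (0\<^sub>m 1 m) (0\<^sub>m m 1) A3 $$ (i, j)"
      using A'0 A'0r n by (cases i; cases j) (auto simp: E_def A3_def)
  qed (use A' n E A3 in auto)
  have h3: "mat_adjoint A3 = A3"
  proof (rule eq_matI)
    fix i j assume "i < dim_row A3" "j < dim_col A3"
    then show "mat_adjoint A3 $$ (i, j) = A3 $$ (i, j)"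
      using A' n arg_cong[OF h', of "\<lambda>M. M $$ (Suc i, Suc j)"] by (simp add: A3_def)
  qed (use A3 in auto)
  have WW: "W * mat_adjoint W = 1\<^sub>m n" using mat_mult_left_right_inverse[OF aW W(1,2)] .
  \<comment> \<open>Similarity preserves the characteristic polynomial and the block form factors
    it. Cancelling the factor of \<open>e\<close> leaves exactly the product over \<open>es\<close>
    needed for the induction hypothesis.\<close>
  have "similar_mat_wit A' A (mat_adjoint W) W"
    using A A' W aW WW by (intro similar_mat_witI[of _ _ n]) (auto simp: A'_def)
  then have "char_poly A' = char_poly A" by (intro char_poly_similar) (auto simp: similar_mat_def)
  moreover have "char_poly A' = char_poly E * char_poly A3"
    unfolding block by (rule char_poly_four_block_zeros_col[OF E _ A3]) simp
  moreover have "char_poly E = [:- e, 1:]"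
    by (simp add: E_def char_poly_defs det_def sign_def)
  ultimately have "[:- e, 1:] * char_poly A3 = [:- e, 1:] * (\<Prod>e\<leftarrow>es. [:- e, 1:])"
    using Cons.prems(3) by simp
  then have "char_poly A3 = (\<Prod>e\<leftarrow>es. [:- e, 1:])"
    by (metis mult_cancel_left pCons_eq_0_iff zero_neq_one)
  from Cons.IH[OF A3 h3 this] obtain U3 where U3: "U3 \<in> carrier_mat m m"
    "mat_adjoint U3 * U3 = 1\<^sub>m m" "mat_adjoint U3 * A3 * U3 = mat_diag m (\<lambda>i. es ! i)" by blast
  \<comment> \<open>The diagonalizing matrix will be \<open>W * F\<close>: \<open>F\<close> fixes
    the first coordinate and diagonalizes the remaining block.\<close>
  define F where "F = four_block_mat (1\<^sub>m 1) (0\<^sub>m 1 m) (0\<^sub>m m 1) U3"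
  have F: "F \<in> carrier_mat n n" using U3 n by (auto simp: F_def)
  have aF: "mat_adjoint F = four_block_mat (1\<^sub>m 1) (0\<^sub>m 1 m) (0\<^sub>m m 1) (mat_adjoint U3)"
    using U3 by (intro eq_matI) (auto simp: F_def)
  have FF: "mat_adjoint F * F = 1\<^sub>m n"
  proof -
    have "mat_adjoint F * F = four_block_mat (1\<^sub>m 1) (0\<^sub>m 1 m) (0\<^sub>m m 1) (mat_adjoint U3 * U3)"
      unfolding aF unfolding F_def using U3(1)
      by (subst mult_four_block_mat[of _ 1 1 _ m _ m _ _ 1 _ m]) auto
    then show ?thesis using U3 n by simp
  qed
  have FAF: "mat_adjoint F * A' * F = mat_diag n (\<lambda>i. (e # es) ! i)"
  proof -
    have "mat_adjoint F * A' = four_block_mat E (0\<^sub>m 1 m) (0\<^sub>m m 1) (mat_adjoint U3 * A3)"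
      unfolding aF block using U3(1) E A3
      by (subst mult_four_block_mat[of _ 1 1 _ m _ m _ _ 1 _ m]) auto
    then have "mat_adjoint F * A' * F = four_block_mat E (0\<^sub>m 1 m) (0\<^sub>m m 1) (mat_adjoint U3 * A3 * U3)"
      unfolding F_def using U3(1) E A3
      by (simp only:, subst mult_four_block_mat[of _ 1 1 _ m _ m _ _ 1 _ m]) (auto simp: mult_carrier_mat[of _ m m _ m])
    also have "\<dots> = mat_diag n (\<lambda>i. (e # es) ! i)"
      unfolding U3(3) using n by (intro eq_matI) (auto simp: E_def mat_diag_def nth_Cons')
    finally show ?thesis .
  qed
  have aU: "mat_adjoint (W * F) = mat_adjoint F * mat_adjoint W" using mat_adjoint_mult[OF W(1) F] .
  have aFc: "mat_adjoint F \<in> carrier_mat n n" using F by simp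
  note mc = mult_carrier_mat[of _ n n _ n] and as = assoc_mult_mat[of _ n n _ n _ n]
  have "mat_adjoint (W * F) * (W * F) = mat_adjoint F * (mat_adjoint W * W) * F"
    unfolding aU using F aFc W(1) aW by (simp add: as mc)
  then have 1: "mat_adjoint (W * F) * (W * F) = 1\<^sub>m n" using W(2) FF F aFc by simp
  have "mat_adjoint (W * F) * A * (W * F) = mat_adjoint F * A' * F"
    unfolding aU A'_def using F aFc W(1) aW A by (simp add: as mc)
  with FAF 1 mc[OF W(1) F] show ?case by auto
qed

section \<open>Decreasing eigenvalue lists and the spectral decomposition\<close>

text \<open>The order of \<open>x\<close> as a root of such a product is the number of occurrences
  of \<open>x\<close> in the list.\<close>

lemma prod_list_linear_factors_eq_iff:
  fixes as bs :: "'a :: field list"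
  shows "(\<Prod>a\<leftarrow>as. [:- a, 1:]) = (\<Prod>b\<leftarrow>bs. [:- b, 1:]) \<longleftrightarrow> mset as = mset bs"
proof
  assume eq: "(\<Prod>a\<leftarrow>as. [:- a, 1:]) = (\<Prod>b\<leftarrow>bs. [:- b, 1:])"
  have "order x (\<Prod>a\<leftarrow>cs. [:- a, 1:]) = count (mset cs) x" for x and cs :: "'a list"
  proof (induction cs)
    case (Cons c cs)
    have "(\<Prod>a\<leftarrow>c # cs. [:- a, 1:]) \<noteq> 0" by (simp only: prod_list_zero_iff) auto
    then have "order x (\<Prod>a\<leftarrow>c # cs. [:- a, 1:]) = order x [:- c, 1:] + count (mset cs) x"
      using Cons by (simp add: order_mult del: mult_pCons_left)
    moreover have "order x [:- c, 1:] = (if x = c then 1 else 0)"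
      using order_power_n_n[of c 1] by (auto intro: order_0I)
    ultimately show ?case by auto
  qed (simp add: order_0I)
  with eq show "mset as = mset bs" by (metis multiset_eqI)
next
  assume "mset as = mset bs"
  then show "(\<Prod>a\<leftarrow>as. [:- a, 1:]) = (\<Prod>b\<leftarrow>bs. [:- b, 1:])"
    by (metis mset_map prod_mset_prod_list)
qed

text \<open>The characteristic polynomial determines the multiset of roots, and a decreasing list is
  determined by its multiset. Hence the definite description in \<open>eigs_desc\<close> has a
  unique solution once one is exhibited.\<close>

lemma eigs_desc_eqI:
  assumes X: "X \<in> carrier_mat n n" and s: "sorted_wrt (\<ge>) ls"
    and c: "char_poly X = (\<Prod>l\<leftarrow>ls. [:- complex_of_real l, 1:])"
  shows "eigs_desc X = ls" "length ls = n"
proof -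
  have map: "(\<Prod>l\<leftarrow>ms. [:- complex_of_real l, 1:]) = (\<Prod>l\<leftarrow>map complex_of_real ms. [:- l, 1:])" for ms
    by (simp add: o_def)
  have deg: "degree (\<Prod>l\<leftarrow>ms. [:- complex_of_real l, 1:]) = length ms" for ms
    using degree_linear_factors[of uminus "map complex_of_real ms"] by (simp add: o_def)
  show len: "length ls = n" using degree_monic_char_poly[OF X] deg[of ls] c by simp
  have "ms = ls" if ms: "sorted_wrt (\<ge>) ms" "char_poly X = (\<Prod>l\<leftarrow>ms. [:- complex_of_real l, 1:])" for ms
  proof -
    have "mset (map complex_of_real ms) = mset (map complex_of_real ls)"
      using ms(2) c unfolding map prod_list_linear_factors_eq_iff[symmetric] by simp
    \<comment> \<open>Taking real parts undoes the embedding of the real lists into the complex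
      numbers.\<close>
    then have "image_mset Re (mset (map complex_of_real ms)) = image_mset Re (mset (map complex_of_real ls))"
      by simp
    then have "mset ms = mset ls" by (simp add: multiset.map_comp o_def)
    then have "mset (rev ms) = mset (rev ls)" by simp
    moreover have "sorted (rev ms)" "sorted (rev ls)" using ms(1) s by (simp_all add: sorted_wrt_rev)
    ultimately have "rev ms = rev ls" by (metis properties_for_sort)
    then show ?thesis by simp
  qed
  then show "eigs_desc X = ls" unfolding eigs_desc_def using X len s c
    by (intro the_equality) auto
qed

lemma pos_semidef_spectral:
  assumes P: "P \<in> carrier_mat n n" and psd: "pos_semidef_mat P"
  obtains U where "U \<in> carrier_mat n n" "mat_adjoint U * U = 1\<^sub>m n" "U * mat_adjoint U = 1\<^sub>m n"
    "P = U * mat_diag n (\<lambda>i. of_real (eigs_desc P ! i)) * mat_adjoint U"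
    "length (eigs_desc P) = n" "sorted_wrt (\<ge>) (eigs_desc P)" "\<And>i. i < n \<Longrightarrow> eigs_desc P ! i \<ge> 0"
proof -
  have h: "mat_adjoint P = P" using psd by (simp add: pos_semidef_mat_def hermitian_mat_def)
  obtain as where as: "char_poly P = (\<Prod>a\<leftarrow>as. [:- a, 1:])" "length as = n"
    using char_poly_factorized[OF P] by blast
  \<comment> \<open>This first diagonalization, in the arbitrary order of \<open>as\<close>, serves
    to show that the eigenvalues are real.\<close>
  obtain U' where U': "U' \<in> carrier_mat n n" "mat_adjoint U' * P * U' = mat_diag n (\<lambda>i. as ! i)"
    using hermitian_diagonalization[OF P h as(1)] by blast
  have "mat_adjoint (mat_adjoint U' * P * U') = mat_adjoint U' * P * U'"
    using P U'(1) h by (simp add: mat_adjoint_mult[of _ n n _ n] assoc_mult_mat[of _ n n _ n _ n]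
        mult_carrier_mat[of _ n n _ n])
  then have Dh: "mat_adjoint (mat_diag n (\<lambda>i. as ! i)) = mat_diag n (\<lambda>i. as ! i)"
    unfolding U'(2) .
  have "cnj (as ! i) = as ! i" if "i < n" for i
    using arg_cong[OF Dh, of "\<lambda>M. M $$ (i, i)"] that by (simp add: mat_diag_def)
  then have real: "of_real (Re a) = a" if "a \<in> set as" for a
    using that as(2) by (auto simp: in_set_conv_nth complex_eq_iff)
  define ls where "ls = rev (sort (map Re as))"
  have sorted: "sorted_wrt (\<ge>) ls" by (simp add: ls_def sorted_wrt_rev)
  have "mset (map complex_of_real ls) = mset (map (\<lambda>a. of_real (Re a)) as)"
    by (simp add: ls_def multiset.map_comp o_def)
  also have "map (\<lambda>a. of_real (Re a)) as = as" using real by (simp add: map_idI)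
  finally have "char_poly P = (\<Prod>a\<leftarrow>map complex_of_real ls. [:- a, 1:])"
    unfolding as(1) by (simp only: prod_list_linear_factors_eq_iff)
  then have cp: "char_poly P = (\<Prod>l\<leftarrow>ls. [:- complex_of_real l, 1:])" by (simp add: o_def)
  note e = eigs_desc_eqI[OF P sorted cp]
  \<comment> \<open>The diagonalization is repeated with the sorted list, so that the diagonal is
    \<open>eigs_desc P\<close> itself.\<close>
  obtain U where U: "U \<in> carrier_mat n n" "mat_adjoint U * U = 1\<^sub>m n"
      "mat_adjoint U * P * U = mat_diag n (\<lambda>i. map complex_of_real ls ! i)"
    using hermitian_diagonalization[OF P h, of "map complex_of_real ls"] cp by (auto simp: o_def)
  have aU: "mat_adjoint U \<in> carrier_mat n n" using U by simp
  have UU: "U * mat_adjoint U = 1\<^sub>m n" using mat_mult_left_right_inverse[OF aU U(1,2)] .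
  have D: "mat_diag n (\<lambda>i. map complex_of_real ls ! i) = mat_diag n (\<lambda>i. of_real (ls ! i))"
    using e(2) by (intro eq_matI) (auto simp: mat_diag_def)
  have "U * (mat_adjoint U * P * U) * mat_adjoint U = (U * mat_adjoint U) * P * (U * mat_adjoint U)"
    using U(1) aU P by (simp add: assoc_mult_mat[of _ n n _ n _ n] mult_carrier_mat[of _ n n _ n])
  then have PU: "P = U * mat_diag n (\<lambda>i. of_real (ls ! i)) * mat_adjoint U"
    using UU P U(3) D by simp
  have "ls ! i \<ge> 0" if i: "i < n" for i
  proof -
    have "complex_of_real (ls ! i) = (mat_adjoint U * P * U) $$ (i, i)"
      unfolding U(3) D using i by (simp add: mat_diag_def)
    also have "\<dots> = conjugate (col U i) \<bullet> (P *\<^sub>v col U i)"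
      using adjoint_congruence_diagonal[OF P U(1) i] .
    finally have "ls ! i = Re (conjugate (col U i) \<bullet> (P *\<^sub>v col U i))" by (metis Re_complex_of_real)
    moreover have "col U i \<in> carrier_vec (dim_row P)" using U(1) P by (simp add: carrier_vecI)
    ultimately show ?thesis using psd by (simp add: pos_semidef_mat_def)
  qed
  then show ?thesis using that[OF U(1,2) UU] PU e sorted by simp
qed

section \<open>Bounds for determinants of compressions\<close>

text \<open>Among \<open>k\<close> distinct indices the initial segment has the largest weights. The
  induction removes the largest index.\<close>

lemma prod_le_prod_initial_segment:
  fixes d :: "nat \<Rightarrow> real"
  assumes "finite S" "S \<subseteq> {..<n}" "card S = k"
    and mono: "\<And>i j. i \<le> j \<Longrightarrow> j < n \<Longrightarrow> d j \<le> d i" and nonneg: "\<And>i. i < n \<Longrightarrow> 0 \<le> d i"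
  shows "prod d S \<le> (\<Prod>j<k. d j)"
  using assms(1-3)
proof (induction k arbitrary: S)
  case (Suc k)
  let ?m = "Max S"
  have ne: "S \<noteq> {}" using Suc.prems(3) by auto
  have m: "?m \<in> S" using Max_in[OF Suc.prems(1) ne] .
  \<comment> \<open>A set of \<open>Suc k\<close> natural numbers has maximum at least
    \<open>k\<close>, so the removed factor is at most \<open>d k\<close>.\<close>
  have "S \<subseteq> {..?m}" using Suc.prems(1) by auto
  then have "card S \<le> Suc ?m" using card_mono[of "{..?m}" S] by simp
  then have km: "k \<le> ?m" using Suc.prems(3) by simp
  have mn: "?m < n" using m Suc.prems(2) by auto
  have IH: "prod d (S - {?m}) \<le> (\<Prod>j<k. d j)"
    using Suc.prems m by (intro Suc.IH) auto
  have "prod d S = d ?m * prod d (S - {?m})" using prod.remove[OF Suc.prems(1) m] .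
  also have "\<dots> \<le> d k * (\<Prod>j<k. d j)"
    using mono[OF km mn] IH nonneg km mn Suc.prems(2)
    by (intro mult_mono) (auto intro!: prod_nonneg)
  finally show ?case by (simp add: mult.commute)
qed simp

text \<open>In an eigenbasis of \<open>P\<close> both determinants expand by
  \<open>det_gram_diag\<close> with the same nonnegative squared minors. Only the eigenvalue
  products differ, and each that matters is at most the product of the \<open>k\<close> largest
  eigenvalues.\<close>

lemma det_compression_le:
  assumes P: "P \<in> carrier_mat n n" and psd: "pos_semidef_mat P" and W: "W \<in> carrier_mat n k"
  shows "Re (det (mat_adjoint W * P * W)) \<le> (\<Prod>j<k. eigs_desc P ! j) * Re (det (mat_adjoint W * W))"
proof -
  obtain U where U: "U \<in> carrier_mat n n" "mat_adjoint U * U = 1\<^sub>m n" "U * mat_adjoint U = 1\<^sub>m n"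
    "P = U * mat_diag n (\<lambda>i. of_real (eigs_desc P ! i)) * mat_adjoint U"
    "length (eigs_desc P) = n" "sorted_wrt (\<ge>) (eigs_desc P)" "\<And>i. i < n \<Longrightarrow> eigs_desc P ! i \<ge> 0"
    by (rule pos_semidef_spectral[OF P psd]) blast
  define d where "d i = eigs_desc P ! i" for i
  have dpos: "d i \<ge> 0" if "i < n" for i using U(7)[OF that] by (simp add: d_def)
  have dmono: "d j \<le> d i" if "i \<le> j" "j < n" for i j
    using that U(5,6) by (cases "i = j") (auto simp: d_def sorted_wrt_iff_nth_less)
  define W' where "W' = mat_adjoint U * W"
  have aU: "mat_adjoint U \<in> carrier_mat n n" and aW: "mat_adjoint W \<in> carrier_mat k n" using U W by auto
  have W': "W' \<in> carrier_mat n k" using aU W by (auto simp: W'_def)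
  have aW': "mat_adjoint W' = mat_adjoint W * U" unfolding W'_def using mat_adjoint_mult[OF aU W] by simp
  let ?D = "mat_diag n (\<lambda>i. complex_of_real (d i))"
  have D: "?D \<in> carrier_mat n n" by simp
  note as = assoc_mult_mat[of _ k n _ n _ n] assoc_mult_mat[of _ k n _ n _ k] assoc_mult_mat[of _ n n _ n _ k]
    assoc_mult_mat[of _ n n _ n _ n] mult_carrier_mat[of _ n n _ n] mult_carrier_mat[of _ n n _ k] mult_carrier_mat[of _ k n _ n]
  have "P = U * ?D * mat_adjoint U" using U(4) by (simp add: d_def)
  then have e1: "mat_adjoint W * P * W = mat_adjoint W' * ?D * W'"
    unfolding aW' unfolding W'_def using U(1) aU aW W D by (simp add: as)
  have "mat_adjoint W' * W' = mat_adjoint W * ((U * mat_adjoint U) * W)"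
    unfolding aW' unfolding W'_def using U(1) aU aW W by (simp add: as)
  \<comment> \<open>The identity is written as a diagonal matrix with constant weight 1, so that one
    expansion covers both determinants.\<close>
  then have e2: "mat_adjoint W * W = mat_adjoint W' * mat_diag n (\<lambda>i. complex_of_real 1) * W'"
    using U(3) W aW W' by simp
  define F where "F = {0..<k} \<rightarrow>\<^sub>E {0..<n}"
  define S where "S f = (cmod (det (mat k k (\<lambda>(i, j). W' $$ (f i, j)))))\<^sup>2" for f :: "nat \<Rightarrow> nat"
  have g: "fact k * Re (det (mat_adjoint W' * mat_diag n (\<lambda>i. of_real (c i)) * W'))
    = (\<Sum>f\<in>F. (\<Prod>i<k. c (f i)) * S f)" for c :: "nat \<Rightarrow> real"
  proof -
    have "complex_of_real (fact k) * det (mat_adjoint W' * mat_diag n (\<lambda>i. of_real (c i)) * W')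
      = of_real (\<Sum>f\<in>F. (\<Prod>i<k. c (f i)) * S f)"
      using det_gram_diag[OF W'] by (simp add: F_def S_def)
    then have "Re (complex_of_real (fact k) * det (mat_adjoint W' * mat_diag n (\<lambda>i. of_real (c i)) * W'))
      = (\<Sum>f\<in>F. (\<Prod>i<k. c (f i)) * S f)"
      by (simp only: Re_complex_of_real)
    then show ?thesis
      by (simp only: times_complex.sel(1) Re_complex_of_real Im_complex_of_real mult_zero_left diff_zero)
  qed
  have "fact k * Re (det (mat_adjoint W * P * W)) = (\<Sum>f\<in>F. (\<Prod>i<k. d (f i)) * S f)"
    unfolding e1 by (rule g)
  also have "\<dots> \<le> (\<Sum>f\<in>F. (\<Prod>j<k. d j) * S f)"
  proof (rule sum_mono)
    fix f assume f: "f \<in> F"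
    show "(\<Prod>i<k. d (f i)) * S f \<le> (\<Prod>j<k. d j) * S f"
    \<comment> \<open>Distinct indices permit the initial-segment bound; a repeated index gives two
      equal rows and thus a vanishing minor.\<close>
    proof (cases "inj_on f {..<k}")
      case True
      then have "(\<Prod>i<k. d (f i)) = prod d (f ` {..<k})" by (simp add: prod.reindex)
      also have "\<dots> \<le> (\<Prod>j<k. d j)"
        using f True dmono dpos by (intro prod_le_prod_initial_segment[of _ n]) (auto simp: F_def card_image)
      finally show ?thesis by (intro mult_right_mono) (simp_all add: S_def)
    next
      case False
      then obtain i j where ij: "i < k" "j < k" "i \<noteq> j" "f i = f j" by (auto simp: inj_on_def)
      have "det (mat k k (\<lambda>(i, j). W' $$ (f i, j))) = 0"
        by (rule det_identical_rows[OF _ ij(3,1,2)]) (use ij in \<open>auto intro!: eq_vecI\<close>)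
      then show ?thesis by (simp add: S_def)
    qed
  qed
  also have "\<dots> = (\<Prod>j<k. d j) * (fact k * Re (det (mat_adjoint W * W)))"
    unfolding e2 g by (simp add: sum_distrib_left)
  finally have "fact k * Re (det (mat_adjoint W * P * W)) \<le> fact k * ((\<Prod>j<k. d j) * Re (det (mat_adjoint W * W)))"
    by (simp add: mult_ac)
  then show ?thesis by (simp add: d_def)
qed

section \<open>Positive semidefinite square roots\<close>

text \<open>Splitting the diagonal into two copies of its square root displays the matrix as a Gram
  matrix.\<close>

lemma pos_semidef_unitary_diag:
  assumes U: "U \<in> carrier_mat n n" and d: "\<And>i. i < n \<Longrightarrow> d i \<ge> 0"
  shows "pos_semidef_mat (U * mat_diag n (\<lambda>i. of_real (d i)) * mat_adjoint U)"
proof -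
  define Q where "Q = mat_diag n (\<lambda>i. complex_of_real (sqrt (d i)))"
  have Q: "Q \<in> carrier_mat n n" "mat_adjoint Q = Q"
    by (simp add: Q_def) (simp add: Q_def mat_adjoint_diag_of_real)
  have "Q * Q = mat_diag n (\<lambda>i. of_real (d i))"
    unfolding Q_def mat_diag_diag using d by (auto simp: mat_diag_def simp flip: of_real_mult)
  moreover have "mat_adjoint (Q * mat_adjoint U) * (Q * mat_adjoint U) = U * (Q * Q) * mat_adjoint U"
    using U Q by (simp add: mat_adjoint_mult[of _ n n _ n] assoc_mult_mat[of _ n n _ n _ n]
        mult_carrier_mat[of _ n n _ n])
  ultimately show ?thesis using pos_semidef_gram[of "Q * mat_adjoint U" n] U Q
    by (simp add: mult_carrier_mat[of _ n n _ n])
qed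

text \<open>The two roots are compared through the matrix between their eigenbases: an entry of it
  can be nonzero only where the squared eigenvalues agree, and then the nonnegative eigenvalues
  agree as well.\<close>

lemma pos_semidef_sqrt_unique:
  assumes S: "S \<in> carrier_mat n n" "pos_semidef_mat S" and T: "T \<in> carrier_mat n n" "pos_semidef_mat T"
    and eq: "S * S = T * T"
  shows "S = T"
proof -
  obtain U where U: "U \<in> carrier_mat n n" "mat_adjoint U * U = 1\<^sub>m n" "U * mat_adjoint U = 1\<^sub>m n"
    "S = U * mat_diag n (\<lambda>i. of_real (eigs_desc S ! i)) * mat_adjoint U"
    "\<And>i. i < n \<Longrightarrow> eigs_desc S ! i \<ge> 0" by (rule pos_semidef_spectral[OF S]) blast
  obtain V where V: "V \<in> carrier_mat n n" "mat_adjoint V * V = 1\<^sub>m n" "V * mat_adjoint V = 1\<^sub>m n"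
    "T = V * mat_diag n (\<lambda>i. of_real (eigs_desc T ! i)) * mat_adjoint V"
    "\<And>i. i < n \<Longrightarrow> eigs_desc T ! i \<ge> 0" by (rule pos_semidef_spectral[OF T]) blast
  define s t where "s i = eigs_desc S ! i" and "t i = eigs_desc T ! i" for i
  define D E where "D = mat_diag n (\<lambda>i. complex_of_real (s i))" and "E = mat_diag n (\<lambda>i. complex_of_real (t i))"
  have DE: "D \<in> carrier_mat n n" "E \<in> carrier_mat n n" by (simp_all add: D_def E_def)
  define a b where "a = mat_adjoint U" and "b = mat_adjoint V"
  have ab: "a \<in> carrier_mat n n" "b \<in> carrier_mat n n" using U V by (auto simp: a_def b_def)
  have SU: "S = U * D * a" and TV: "T = V * E * b" using U(4) V(4) by (simp_all add: D_def E_def s_def t_def a_def b_def)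
  note inv = U(2,3)[folded a_def] V(2,3)[folded b_def]
  note as = assoc_mult_mat[of _ n n _ n _ n] mult_carrier_mat[of _ n n _ n]
  have cancel: "X * (Y * Z) = Z" if "X * Y = 1\<^sub>m n" "X \<in> carrier_mat n n" "Y \<in> carrier_mat n n" "Z \<in> carrier_mat n n" for X Y Z :: "complex mat"
    using that by (simp flip: as(1))
  \<comment> \<open>\<open>M\<close> relates the two eigenbases, and \<open>S = T\<close> amounts to
    \<open>D * M = M * E\<close>.\<close>
  define M where "M = a * V"
  have M: "M \<in> carrier_mat n n" using ab V by (simp add: M_def as)
  have "D * (D * M) = a * (S * S) * V"
    unfolding SU M_def using U(1) V(1) ab DE by (simp add: as cancel[OF inv(1)])
  also have "\<dots> = M * E * E"
    unfolding eq TV M_def using U(1) V(1) ab DE inv by (simp add: as cancel[OF inv(3)])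
  finally have DDM: "D * (D * M) = M * E * E" .
  have "D * M = M * E"
  proof (rule eq_matI)
    fix i j assume "i < dim_row (M * E)" "j < dim_col (M * E)"
    then have ij: "i < n" "j < n" using M DE by auto
    have "(D * (D * M)) $$ (i, j) = (M * E * E) $$ (i, j)" using DDM by simp
    then have "of_real (s i) * (of_real (s i) * M $$ (i, j)) = M $$ (i, j) * of_real (t j) * of_real (t j)"
      using ij M unfolding D_def E_def
      by (simp add: mat_diag_mult_left[of _ n n] mat_diag_mult_right[of _ n n])
    then have "M $$ (i, j) * of_real ((s i)\<^sup>2 - (t j)\<^sup>2) = 0"
      by (simp add: power2_eq_square algebra_simps)
    then have "M $$ (i, j) = 0 \<or> (s i)\<^sup>2 = (t j)\<^sup>2"
      by (metis mult_eq_0_iff of_real_eq_0_iff right_minus_eq)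
    then have "M $$ (i, j) = 0 \<or> s i = t j"
      using U(5)[OF ij(1)] V(5)[OF ij(2)] by (auto simp: s_def t_def)
    then show "(D * M) $$ (i, j) = (M * E) $$ (i, j)"
      using ij M unfolding D_def E_def
      by (auto simp: mat_diag_mult_left[of _ n n] mat_diag_mult_right[of _ n n])
  qed (use M DE in auto)
  then have "U * (D * M) * b = U * (M * E) * b" by simp
  moreover have "U * (D * M) * b = S"
    unfolding SU M_def using U(1) V(1) ab DE inv by (simp add: as)
  moreover have "U * (M * E) * b = T"
    unfolding TV M_def using U(1) V(1) ab DE by (simp add: as cancel[OF inv(2)])
  ultimately show ?thesis by simp
qed

text \<open>The root built from the spectral decomposition is, by uniqueness, the object selected by
  the definite description in \<open>msqrt\<close>.\<close>

lemma msqrt_pos_semidef: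
  assumes P: "P \<in> carrier_mat n n" and psd: "pos_semidef_mat P"
  shows "msqrt P \<in> carrier_mat n n" "pos_semidef_mat (msqrt P)" "msqrt P * msqrt P = P"
proof -
  obtain U where U: "U \<in> carrier_mat n n" "mat_adjoint U * U = 1\<^sub>m n"
    "P = U * mat_diag n (\<lambda>i. of_real (eigs_desc P ! i)) * mat_adjoint U"
    "\<And>i. i < n \<Longrightarrow> eigs_desc P ! i \<ge> 0" by (rule pos_semidef_spectral[OF P psd]) blast
  define Q where "Q = mat_diag n (\<lambda>i. complex_of_real (sqrt (eigs_desc P ! i)))"
  have Q: "Q \<in> carrier_mat n n" by (simp add: Q_def)
  define S where "S = U * Q * mat_adjoint U"
  have aU: "mat_adjoint U \<in> carrier_mat n n" using U by simp
  have S: "S \<in> carrier_mat n n" using U Q aU by (auto simp: S_def)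
  have Spsd: "pos_semidef_mat S" unfolding S_def Q_def
    using U(1,4) by (intro pos_semidef_unitary_diag) auto
  have QQ: "Q * Q = mat_diag n (\<lambda>i. of_real (eigs_desc P ! i))"
    unfolding Q_def mat_diag_diag using U(4) by (auto simp: mat_diag_def simp flip: of_real_mult)
  have "S * S = U * (Q * ((mat_adjoint U * U) * (Q * mat_adjoint U)))"
    unfolding S_def using U(1) aU Q by (simp add: assoc_mult_mat[of _ n n _ n _ n] mult_carrier_mat[of _ n n _ n])
  also have "\<dots> = U * (Q * Q) * mat_adjoint U"
    unfolding U(2) using U(1) aU Q by (simp add: assoc_mult_mat[of _ n n _ n _ n] mult_carrier_mat[of _ n n _ n])
  finally have SS: "S * S = P" using U(3) QQ by simp
  have "msqrt P = S" unfolding msqrt_def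
  proof (rule the_equality)
    show "S \<in> carrier_mat (dim_row P) (dim_row P) \<and> pos_semidef_mat S \<and> S * S = P"
      using S Spsd SS P by simp
    fix T assume "T \<in> carrier_mat (dim_row P) (dim_row P) \<and> pos_semidef_mat T \<and> T * T = P"
    then show "T = S" using pos_semidef_sqrt_unique[OF _ _ S Spsd, of T] SS P by simp
  qed
  then show "msqrt P \<in> carrier_mat n n" "pos_semidef_mat (msqrt P)" "msqrt P * msqrt P = P"
    using S Spsd SS by auto
qed

section \<open>Cancellation, commuted products and the geometric mean\<close>

text \<open>The right-nested shape fits products normalized by associativity. \<open>Z\<close> may
  be rectangular because it is also applied to frames of \<open>k\<close> vectors.\<close>

lemma square_mat_cancel:
  fixes X Y Z :: "complex mat"
  assumes "X * Y = 1\<^sub>m n" "X \<in> carrier_mat n n" "Y \<in> carrier_mat n n" "Z \<in> carrier_mat n k"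
  shows "X * (Y * Z) = Z"
  using assms assoc_mult_mat[of X n n Y n Z k] by simp

lemma det_minv_nonzero:
  assumes "A \<in> carrier_mat n n" "det A \<noteq> 0"
  shows "det (minv A) \<noteq> 0"
  using minv_inverse[OF assms] det_mult[of A n "minv A"] assms by auto

text \<open>Conjugation by \<open>X\<close> takes \<open>Y * X\<close> to \<open>X * Y\<close>, and
  \<open>eigs_desc\<close> depends only on the dimension and the characteristic polynomial.\<close>

lemma eigs_desc_commute:
  fixes X Y :: "complex mat"
  assumes X: "X \<in> carrier_mat n n" and Y: "Y \<in> carrier_mat n n" and d: "det X \<noteq> 0"
  shows "eigs_desc (X * Y) = eigs_desc (Y * X)"
proof -
  note i = minv_inverse[OF X d]
  have "similar_mat_wit (X * Y) (Y * X) X (minv X)"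
  proof (rule similar_mat_witI[of _ _ n])
    show "X * Y = X * (Y * X) * minv X"
      using X Y i by (simp add: assoc_mult_mat[of _ n n _ n _ n] mult_carrier_mat[of _ n n _ n])
  qed (use X Y i in auto)
  then have "char_poly (X * Y) = char_poly (Y * X)"
    by (intro char_poly_similar) (auto simp: similar_mat_def)
  then show ?thesis using X Y by (simp add: eigs_desc_def)
qed

text \<open>With \<open>C\<close> inverse to \<open>R\<close> and \<open>K * K = C * B * C\<close>,
  the mean is \<open>R * K * R\<close>. As \<open>R * A * R\<close> is the identity,
  \<open>G * A * G\<close> collapses to \<open>R * (K * K) * R\<close>, which is
  \<open>B\<close>.\<close>

lemma geo_mean_riccati:
  assumes A: "A \<in> carrier_mat n n" "pos_def_mat A" and B: "B \<in> carrier_mat n n" "pos_def_mat B"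
  defines "R \<equiv> msqrt (minv A)" and "G \<equiv> geo_mean (minv A) B"
  shows "R \<in> carrier_mat n n" "mat_adjoint R = R" "R * R = minv A" "det R \<noteq> 0"
    "G \<in> carrier_mat n n" "mat_adjoint G = G" "G * A * G = B" "det G \<noteq> 0"
proof -
  have dA: "det A \<noteq> 0" using pos_def_det_nonzero[OF A] .
  note iA = minv_inverse[OF A(1) dA]
  have hA: "mat_adjoint A = A" using A by (simp add: pos_def_mat_def hermitian_mat_def)
  \<comment> \<open>The inverse of \<open>A\<close> is a congruence of \<open>A\<close>, and so
    inherits positive semidefiniteness.\<close>
  have "mat_adjoint (minv A) * A * minv A = minv A"
    unfolding minv_adjoint[OF A(1) dA hA] using iA by simp
  then have "pos_semidef_mat (minv A)"
    using pos_semidef_congruence[OF A(1) pos_def_imp_pos_semidef[OF A(2)] iA(1)] by simp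
  note r = msqrt_pos_semidef[OF iA(1) this, folded R_def]
  show R: "R \<in> carrier_mat n n" "R * R = minv A" using r by auto
  show hR: "mat_adjoint R = R" using r by (simp add: pos_semidef_mat_def hermitian_mat_def)
  show dR: "det R \<noteq> 0" using det_mult[OF R(1) R(1)] R(2) det_minv_nonzero[OF A(1) dA] by auto
  define C where "C = minv R"
  note iR = minv_inverse[OF R(1) dR, folded C_def]
  have hC: "mat_adjoint C = C" using minv_adjoint[OF R(1) dR hR] by (simp add: C_def)
  define K where "K = msqrt (C * B * C)"
  have "pos_semidef_mat (C * B * C)"
    using pos_semidef_congruence[OF B(1) pos_def_imp_pos_semidef[OF B(2)] iR(1)] hC by simp
  moreover have "C * B * C \<in> carrier_mat n n" using iR B by auto
  ultimately have K: "K \<in> carrier_mat n n" "pos_semidef_mat K" "K * K = C * B * C"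
    using msqrt_pos_semidef[of "C * B * C" n] by (auto simp: K_def)
  have hK: "mat_adjoint K = K" using K by (simp add: pos_semidef_mat_def hermitian_mat_def)
  have G: "G = R * K * R" by (simp add: G_def geo_mean_def R_def K_def C_def)
  note as = assoc_mult_mat[of _ n n _ n _ n] mult_carrier_mat[of _ n n _ n]
  show Gc: "G \<in> carrier_mat n n" using R K by (simp add: G as)
  show "mat_adjoint G = G" using R K hR hK by (simp add: G as mat_adjoint_mult[of _ n n _ n])
  \<comment> \<open>Since \<open>R * R\<close> is inverse to \<open>A\<close>, the product
    \<open>R * A\<close> is \<open>C\<close>, the inverse of \<open>R\<close>.\<close>
  have "R * (A * R) = 1\<^sub>m n"
  proof -
    have "R * (R * A) = 1\<^sub>m n" using R iA A(1) by (simp flip: as(1))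
    then have "R * A = C" using R A(1) iR square_mat_cancel[OF iR(3,1) R(1), of "R * A" n] by (simp add: as)
    then show ?thesis using R A(1) iR by (simp flip: as(1))
  qed
  note RAR = square_mat_cancel[OF this R(1)]
  have "G * A * G = R * (K * (R * (A * (R * (K * R)))))"
    using R K A(1) by (simp add: G as)
  also have "\<dots> = R * (K * (R * ((A * R) * (K * R))))" using R K A(1) by (simp add: as)
  also have "\<dots> = R * (K * (K * R))" using R K A(1) by (subst RAR[of _ n]) (auto simp: as)
  also have "\<dots> = R * ((K * K) * R)" using R(1) K(1) by (simp add: as)
  also have "\<dots> = R * (C * (B * (C * R)))" unfolding K(3) using R iR(1) B(1) by (simp add: as)
  also have "\<dots> = B" using iR B(1) R by (simp add: square_mat_cancel[OF iR(2) R(1) iR(1), of _ n])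
  finally show GAG: "G * A * G = B" .
  have "det B \<noteq> 0" using pos_def_det_nonzero[OF B] .
  moreover have "det B = det (G * A) * det G" using GAG det_mult[of "G * A" n G] Gc A(1) by auto
  ultimately show "det G \<noteq> 0" by auto
qed

section \<open>The inequality for products of the largest eigenvalues\<close>

text \<open>\<open>B\<close> enters only through its inverse: in the application \<open>H\<close>
  inverts the geometric mean, \<open>R * R\<close> is \<open>minv A\<close>, and
  \<open>H * (R * R) * H\<close> is \<open>minv B\<close>.\<close>

lemma eigs_desc_prod_le:
  assumes A: "A \<in> carrier_mat n n" "mat_adjoint A = A" and H: "H \<in> carrier_mat n n" "mat_adjoint H = H" "det H \<noteq> 0"
    and C: "C \<in> carrier_mat n n" "mat_adjoint C = C" "C * C = A" "det C \<noteq> 0"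
    and R: "R \<in> carrier_mat n n" "mat_adjoint R = R" "C * R = 1\<^sub>m n"
    and k: "k \<le> n"
  shows "(\<Prod>j<k. eigs_desc (H * A * H) ! j) \<le> (\<Prod>j<k. eigs_desc (A * H * (R * R) * H * A) ! j)"
proof -
  note as = assoc_mult_mat[of _ n n _ n _ n] mult_carrier_mat[of _ n n _ n] mat_adjoint_mult[of _ n n _ n]
  note ask = assoc_mult_mat[of _ n n _ n _ k] mult_carrier_mat[of _ n n _ k] assoc_mult_mat[of _ k n _ n _ n]
    assoc_mult_mat[of _ k n _ n _ k] mult_carrier_mat[of _ k n _ k] mult_carrier_mat[of _ k n _ n] mat_adjoint_mult[of _ n n _ k]
    mult_carrier_mat[of _ n k _ k] assoc_mult_mat[of _ n k _ k _ k] assoc_mult_mat[of _ n n _ k _ k] assoc_mult_mat[of _ k n _ k _ k]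
    mult_carrier_mat[of _ k k _ k] mult_carrier_mat[of _ k k _ n] assoc_mult_mat[of _ k k _ n _ n] assoc_mult_mat[of _ k k _ n _ k]
    assoc_mult_mat[of _ k k _ k _ k] mat_adjoint_mult[of _ n k _ k] 
  have RC: "R * C = 1\<^sub>m n" using mat_mult_left_right_inverse[OF C(1) R(1,3)] .
  define P where "P = H * A * H"
  define Y where "Y = A * H * (R * R) * H * A"
  define X where "X = C * H * (H * C)"
  define G where "G = minv H"
  note iH = minv_inverse[OF H(1,3), folded G_def]
  have hG: "mat_adjoint G = G" using minv_adjoint[OF H(1,3,2)] by (simp add: G_def)
  have P: "P \<in> carrier_mat n n" and Y: "Y \<in> carrier_mat n n" and X: "X \<in> carrier_mat n n"
    using A H C R by (simp_all add: P_def Y_def X_def as)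
  have "P = mat_adjoint (C * H) * (C * H)"
    using H C by (simp add: P_def as C(3)[symmetric])
  then have psdP: "pos_semidef_mat P" using pos_semidef_gram[of "C * H" n] H C by (simp add: as)
  have "X = mat_adjoint (H * C) * (H * C)" using H C by (simp add: X_def as)
  then have psdX: "pos_semidef_mat X" using pos_semidef_gram[of "H * C" n] H C by (simp add: as)
  have "Y = mat_adjoint (R * H * A) * (R * H * A)" using H A R by (simp add: Y_def as)
  then have psdY: "pos_semidef_mat Y" using pos_semidef_gram[of "R * H * A" n] H A R by (simp add: as)
  have psdG: "pos_semidef_mat (G * G)" using pos_semidef_gram[OF iH(1)] hG by simp
  have dCH: "det (C * H) \<noteq> 0" using det_mult[OF C(1) H(1)] C(4) H(3) by simp
  \<comment> \<open>\<open>X\<close> and \<open>P\<close> are products of \<open>C * H\<close> and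
    \<open>H * C\<close> in opposite orders, hence have the same eigenvalues.\<close>
  have "X = (C * H) * (H * C)" by (simp add: X_def)
  moreover have "P = (H * C) * (C * H)" using H C by (simp add: P_def as C(3)[symmetric])
  ultimately have eigsX: "eigs_desc X = eigs_desc P"
    using eigs_desc_commute[of "C * H" n "H * C"] dCH H C by (simp add: as)
  obtain U where U: "U \<in> carrier_mat n n" "mat_adjoint U * U = 1\<^sub>m n"
    "P = U * mat_diag n (\<lambda>i. of_real (eigs_desc P ! i)) * mat_adjoint U"
    "\<And>i. i < n \<Longrightarrow> eigs_desc P ! i \<ge> 0" by (rule pos_semidef_spectral[OF P psdP]) blast
  define d where "d i = eigs_desc P ! i" for i
  define p where "p = (\<Prod>j<k. d j)"
  let ?D = "mat_diag n (\<lambda>i. complex_of_real (d i))"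
  have UD: "P = U * ?D * mat_adjoint U" using U(3) by (simp add: d_def)
  have aU: "mat_adjoint U \<in> carrier_mat n n" using U by simp
  have PU: "P * U = U * ?D" using U(1,2) aU by (subst UD) (simp add: as right_mult_one_mat[of _ n n])
  \<comment> \<open>The determinant of \<open>P\<close> is nonzero, so its nonnegative eigenvalues
    are positive; this later allows division by \<open>p\<close>.\<close>
  have dpos: "d i > 0" if i: "i < n" for i
  proof -
    have "det P = det H * det A * det H" using H A by (simp add: P_def det_mult[of _ n] as)
    moreover have "det A = det C * det C" using C det_mult[OF C(1) C(1)] by simp
    ultimately have "det P \<noteq> 0" using H(3) C(4) by simp
    moreover have "det P = det U * det ?D * det (mat_adjoint U)"
      using U(1) aU by (subst UD) (simp add: det_mult[of _ n] as)
    moreover have "det ?D = (\<Prod>i<n. of_real (d i))"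
    proof -
      have "det ?D = prod_list (diag_mat ?D)"
        by (rule det_upper_triangular[of _ n]) (auto simp: mat_diag_def)
      then show ?thesis by (simp add: diag_mat_def mat_diag_def prod.list_conv_set_nth atLeast0LessThan)
    qed
    ultimately have "d i \<noteq> 0" using i by auto
    then show ?thesis using U(4)[OF i] by (simp add: d_def)
  qed
  have p: "p > 0" unfolding p_def using dpos k by (intro prod_pos) auto
  \<comment> \<open>The columns of \<open>Uk\<close> are orthonormal eigenvectors for the
    \<open>k\<close> largest eigenvalues of \<open>P\<close>.\<close>
  define Uk where "Uk = mat n k (\<lambda>(i, j). U $$ (i, j))"
  define Dk where "Dk = mat_diag k (\<lambda>i. complex_of_real (d i))"
  have Uk: "Uk \<in> carrier_mat n k" and Dk: "Dk \<in> carrier_mat k k" by (simp_all add: Uk_def Dk_def)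
  have colUk: "col Uk j = col U j" if "j < k" for j
    using that k U(1) by (intro eq_vecI) (auto simp: Uk_def)
  have PUk: "P * Uk = Uk * Dk"
  proof (rule eq_matI)
    fix i j assume "i < dim_row (Uk * Dk)" "j < dim_col (Uk * Dk)"
    then have ij: "i < n" "j < k" using Uk Dk by auto
    have "(P * Uk) $$ (i, j) = (P * U) $$ (i, j)" using ij P Uk U(1) colUk k by simp
    also have "\<dots> = (Uk * Dk) $$ (i, j)"
      unfolding PU Dk_def using ij k U(1) Uk
      by (simp add: mat_diag_mult_right[of _ n n] mat_diag_mult_right[of _ n k]) (simp add: Uk_def)
    finally show "(P * Uk) $$ (i, j) = (Uk * Dk) $$ (i, j)" .
  qed (use P Uk Dk in auto)
  have UkUk: "mat_adjoint Uk * Uk = 1\<^sub>m k"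
  proof (rule eq_matI)
    fix i j assume "i < dim_row (1\<^sub>m k :: complex mat)" "j < dim_col (1\<^sub>m k :: complex mat)"
    then have ij: "i < k" "j < k" by auto
    have "row (mat_adjoint Uk) i = row (mat_adjoint U) i"
      using ij k U(1) by (intro eq_vecI) (auto simp: Uk_def)
    then have "(mat_adjoint Uk * Uk) $$ (i, j) = (mat_adjoint U * U) $$ (i, j)"
      using ij Uk U(1) colUk k by simp
    then show "(mat_adjoint Uk * Uk) $$ (i, j) = 1\<^sub>m k $$ (i, j)" unfolding U(2) using ij k by simp
  qed (use Uk in auto)
  \<comment> \<open>\<open>H\<close> carries eigenvectors of \<open>H * A * H\<close> to
    eigenvectors of \<open>H * H * A\<close> with the same eigenvalues. Orthonormality may be lost,
    so the Gram determinant \<open>\<delta>\<close> is carried along.\<close>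
  define V where "V = H * Uk"
  have V: "V \<in> carrier_mat n k" using H Uk by (simp add: V_def ask)
  define \<delta> where "\<delta> = Re (det (mat_adjoint V * V))"
  \<comment> \<open>Compressing \<open>G * G\<close> by \<open>V\<close> gives back the Gram matrix
    of \<open>Uk\<close>, of determinant 1. The compression bound then forces
    \<open>\<delta>\<close> to be positive.\<close>
  have "Uk = G * V" using square_mat_cancel[OF iH(3,1) H(1) Uk] by (simp add: V_def)
  then have "mat_adjoint Uk * Uk = mat_adjoint V * (G * G) * V"
    using iH(1) V hG by (simp add: ask as)
  then have "1 = Re (det (mat_adjoint V * (G * G) * V))" using UkUk by (metis det_one one_complex.sel(1))
  also have "\<dots> \<le> (\<Prod>j<k. eigs_desc (G * G) ! j) * \<delta>"
    unfolding \<delta>_def using iH(1) by (intro det_compression_le[OF _ psdG V]) (simp add: as)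
  finally have "1 \<le> (\<Prod>j<k. eigs_desc (G * G) ! j) * \<delta>" .
  moreover have "(\<Prod>j<k. eigs_desc (G * G) ! j) \<ge> 0"
  proof -
    have "G * G \<in> carrier_mat n n" using iH(1) by (simp add: as)
    then have "\<And>i. i < n \<Longrightarrow> eigs_desc (G * G) ! i \<ge> 0" by (rule pos_semidef_spectral[OF _ psdG]) blast
    then show ?thesis using k by (intro prod_nonneg) auto
  qed
  ultimately have \<delta>: "\<delta> > 0" using mult_nonneg_nonpos[of "\<Prod>j<k. eigs_desc (G * G) ! j" \<delta>] by linarith
  define M where "M = R * H * A"
  have M: "M \<in> carrier_mat n n" using R H A by (simp add: M_def as)
  have aM: "mat_adjoint M = A * H * R" using R H A by (simp add: M_def as)
  have HHAV: "H * H * A * V = V * Dk"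
  proof -
    have "H * H * A * V = H * (P * Uk)" using H A Uk by (simp add: P_def V_def ask as)
    then show ?thesis unfolding PUk using H Uk Dk by (simp add: V_def ask)
  qed
  have "H * C * M = H * (C * (R * (H * A)))" using H C R A by (simp add: M_def as)
  also have "\<dots> = H * H * A" using H A by (simp add: square_mat_cancel[OF R(3) C(1) R(1), of _ n] as)
  finally have HCM: "H * C * M = H * H * A" .
  define MV where "MV = M * V"
  have MV: "MV \<in> carrier_mat n k" using M V by (simp add: MV_def ask)
  have "H * C * MV = V * Dk"
    unfolding HHAV[symmetric] HCM[symmetric] MV_def using H C M V by (simp add: as ask)
  then have "mat_adjoint (V * Dk) * (V * Dk) = mat_adjoint (H * C * MV) * (H * C * MV)" by simp
  also have "\<dots> = mat_adjoint MV * X * MV"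
    using H C MV by (simp add: X_def as ask)
  finally have 1: "mat_adjoint MV * X * MV = mat_adjoint (V * Dk) * (V * Dk)" by simp
  have aDk: "mat_adjoint Dk = Dk" unfolding Dk_def by (rule mat_adjoint_diag_of_real)
  have detDk: "det Dk = of_real p"
  proof -
    have "det Dk = prod_list (diag_mat Dk)"
      by (rule det_upper_triangular[OF _ Dk]) (auto simp: Dk_def mat_diag_def)
    then show ?thesis by (simp add: Dk_def p_def diag_mat_def mat_diag_def prod.list_conv_set_nth atLeast0LessThan)
  qed
  have "mat_adjoint (V * Dk) * (V * Dk) = Dk * (mat_adjoint V * V) * Dk"
    using V Dk aDk by (simp add: ask)
  moreover have "mat_adjoint V * V \<in> carrier_mat k k" using V by (simp add: ask)
  ultimately have "det (mat_adjoint (V * Dk) * (V * Dk)) = of_real p * det (mat_adjoint V * V) * of_real p"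
    using Dk det_mult[of "Dk * (mat_adjoint V * V)" k Dk] det_mult[of Dk k "mat_adjoint V * V"]
    by (simp only: detDk mult_carrier_mat)
  then have "p * p * \<delta> = Re (det (mat_adjoint MV * X * MV))"
    unfolding 1 \<delta>_def by simp
  \<comment> \<open>First compression bound, for \<open>X\<close>: it costs a single factor
    \<open>p\<close>, because \<open>X\<close> shares its eigenvalues with \<open>P\<close>.\<close>
  also have "\<dots> \<le> p * Re (det (mat_adjoint MV * MV))"
    using det_compression_le[OF X psdX MV] unfolding eigsX by (simp add: p_def d_def)
  also have "mat_adjoint MV * MV = mat_adjoint V * Y * V"
    unfolding MV_def Y_def using M V aM A H R by (simp add: as ask) (simp add: M_def as ask)
  \<comment> \<open>Second compression bound, for \<open>Y\<close>: it returns to the frame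
    \<open>V\<close>, so \<open>\<delta>\<close> and one factor \<open>p\<close> can be
    cancelled.\<close>
  also have "Re (det (mat_adjoint V * Y * V)) \<le> (\<Prod>j<k. eigs_desc Y ! j) * \<delta>"
    unfolding \<delta>_def by (rule det_compression_le[OF Y psdY V])
  finally have "p * p * \<delta> \<le> p * ((\<Prod>j<k. eigs_desc Y ! j) * \<delta>)" using p by simp
  then have "p \<le> (\<Prod>j<k. eigs_desc Y ! j)" using p \<delta> by (simp add: mult.assoc)
  then show ?thesis by (simp add: p_def d_def P_def Y_def)
qed

section \<open>Log-majorization for the spectral mean\<close>

theorem theorem4p6:
  fixes A B :: "complex mat" and n :: nat
  assumes "A \<in> carrier_mat n n" and "B \<in> carrier_mat n n"
    and "pos_def_mat A" and "pos_def_mat B"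
  shows "log_majorized (sp_hat_m1 A B) (A * minv B * A)"
proof -
  note A = assms(1,3) and B = assms(2,4)
  note as = assoc_mult_mat[of _ n n _ n _ n] mult_carrier_mat[of _ n n _ n]
  define R where "R = msqrt (minv A)"
  define G where "G = geo_mean (minv A) B"
  note RG = geo_mean_riccati[OF A B, folded R_def G_def]
  define C where "C = minv R"
  define H where "H = minv G"
  note iR = minv_inverse[OF RG(1,4), folded C_def] and iG = minv_inverse[OF RG(5,8), folded H_def]
  have hC: "mat_adjoint C = C" and hH: "mat_adjoint H = H"
    using minv_adjoint[OF RG(1,4,2)] minv_adjoint[OF RG(5,8,6)] by (simp_all add: C_def H_def)
  have dC: "det C \<noteq> 0" and dH: "det H \<noteq> 0"
    using det_minv_nonzero[OF RG(1,4)] det_minv_nonzero[OF RG(5,8)] by (simp_all add: C_def H_def)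
  have hA: "mat_adjoint A = A" using A by (simp add: pos_def_mat_def hermitian_mat_def)
  have dA: "det A \<noteq> 0" using pos_def_det_nonzero[OF A] .
  note iA = minv_inverse[OF A(1) dA]
  \<comment> \<open>\<open>C\<close> squares to \<open>A\<close> because its inverse
    \<open>R\<close> squares to the inverse of \<open>A\<close>.\<close>
  have CC: "C * C = A"
  proof -
    have "C * C = C * (C * (R * R * A))" using iR iA RG(3) by simp
    also have "\<dots> = A" using iR(1) RG(1) A(1)
      by (simp add: as square_mat_cancel[OF iR(3,1) RG(1), of _ n])
    finally show ?thesis .
  qed
  \<comment> \<open>Inverting \<open>G * A * G = B\<close> factor by factor gives
    \<open>H * minv A * H\<close> as the inverse of \<open>B\<close>.\<close>
  have "B * (H * (R * R) * H) = G * (A * (G * (H * (minv A * H))))"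
    unfolding RG(3) RG(7)[symmetric] using A(1) iA(1) RG(5) iG(1) by (simp add: as)
  also have "\<dots> = 1\<^sub>m n"
    using A(1) RG(5) iG iA by (simp add: as square_mat_cancel[OF iG(2) RG(5) iG(1), of _ n]
        square_mat_cancel[OF iA(2) A(1) iA(1), of _ n])
  finally have "minv B = H * (R * R) * H"
    using RG(1) iG(1) B(1) by (intro minv_eqI[of B n]) (auto simp: as)
  then have Y: "A * minv B * A = A * H * (R * R) * H * A"
    using A(1) RG(1) iG(1) by (simp add: as)
  have sp: "sp_hat_m1 A B = H * A * H" by (simp add: sp_hat_m1_def H_def G_def)
  \<comment> \<open>This is the factor by which the two determinants differ.\<close>
  have "det A * det R * det R = 1"
    using det_mult[OF A(1) iA(1)] det_mult[OF RG(1) RG(1)] unfolding iA(2) RG(3) by (simp add: mult.assoc)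
  moreover have "det (A * H * (R * R) * H * A) = (det A * det R * det R) * (det H * det A * det H)"
    using A(1) RG(1) iG(1) by (simp add: det_mult[of _ n] as)
  moreover have "det (H * A * H) = det H * det A * det H"
    using A(1) iG(1) by (simp add: det_mult[of _ n] as)
  ultimately have "det (A * H * (R * R) * H * A) = det (H * A * H)" by simp
  moreover have "\<forall>k\<in>{1..<dim_row (H * A * H)}. (\<Prod>j<k. eigs_desc (H * A * H) ! j)
      \<le> (\<Prod>j<k. eigs_desc (A * H * (R * R) * H * A) ! j)"
    using eigs_desc_prod_le[OF A(1) hA iG(1) hH dH iR(1) hC CC dC RG(1,2) iR(3)] iG(1) by auto
  ultimately show ?thesis unfolding log_majorized_def sp Y by simp
qed

end
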